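(* Let $\mathcal{F}$ be a family of numerical semigroups and let $\Delta$ be a numerical semigroup such that $S\subseteq\Delta$ for all $S\in\mathcal{F}$. If $A\subseteq\Delta$, then $B=\{x_S\mid S\in\mathcal{F}\text{ and }A\not\subseteq S\}$, where $x_S=\min\{a\in A\mid a\notin S\}$ for each $S\in\mathcal{F}$ with $A\not\subseteq S$, is the minimal $\mathcal{R}(\mathcal{F},\Delta)$-system of generators of $\mathcal{R}(\mathcal{F},\Delta)(A)$.
   Context: Let $\mathbb{N}$ be the set of nonnegative integers. A numerical semigroup is a subset $S\subseteq\mathbb{N}$ that is closed under addition, contains $0$, and has $\mathbb{N}\setminus S$ finite. If $S\subsetneq T$ are numerical semigroups, $\mathrm{F}_T(S)=\max(T\setminus S)$. An $R$-variety is a non-empty family $\mathcal{R}$ of numerical semigroups such that: (1) $\mathcal{R}$ has a maximum element with respect to inclusion, denoted $\Delta(\mathcal{R})$; (2) if $S,T\in\mathcal{R}$ then $S\cap T\in\mathcal{R}$; (3) if $S\in\mathcal{R}$ and $S\neq\Delta(\mathcal{R})$ then $S\cup\{\mathrm{F}_{\Delta(\mathcal{R})}(S)\}\in\mathcal{R}$. $\mathcal{R}(\mathcal{F},\Delta)$ denotes the smallest $R$-variety which contains $\mathcal{F}$ and has maximum equal to $\Delta$ (it exists and equals the intersection of all $R$-varieties containing $\mathcal{F}$ with maximum $\Delta$). For an $R$-variety $\mathcal{R}$, an $\mathcal{R}$-monoid is a submonoid of $(\mathbb{N},+)$ that is the intersection of a (non-empty, possibly infinite) family of elements of $\mathcal{R}$.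 For $A\subseteq\Delta(\mathcal{R})$, $\mathcal{R}(A)$ denotes the $\mathcal{R}$-monoid generated by $A$: the intersection of all $\mathcal{R}$-monoids containing $A$. If $M=\mathcal{R}(A)$, then $A$ is an $\mathcal{R}$-system of generators of $M$; it is a minimal $\mathcal{R}$-system of generators of $M$ if moreover $M\neq\mathcal{R}(B)$ for all $B\subsetneq A$. Every $\mathcal{R}$-monoid has a unique minimal $\mathcal{R}$-system of generators. Thus $\mathcal{R}(\mathcal{F},\Delta)(A)$ is the $\mathcal{R}(\mathcal{F},\Delta)$-monoid generated by $A$. *)

theory Defs
  imports Main
begin

definition submonoid_nat :: "nat set \<Rightarrow> bool" where
  "submonoid_nat M \<longleftrightarrow> 0 \<in> M \<and> (\<forall>x\<in>M. \<forall>y\<in>M. x + y \<in> M)"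

definition numerical_semigroup :: "nat set \<Rightarrow> bool" where
  "numerical_semigroup S \<longleftrightarrow> submonoid_nat S \<and> finite (UNIV - S)"

text \<open>\<open>rel_frobenius T S\<close> is the restricted Frobenius number $F_T(S)$. It is meaningful only for
  numerical semigroups \<open>S \<subset> T\<close>, for which \<open>T - S\<close> is finite and non-empty.\<close>

definition rel_frobenius :: "nat set \<Rightarrow> nat set \<Rightarrow> nat" where
  "rel_frobenius T S = Max (T - S)"

text \<open>The maximum element $\Delta(R)$; it is meaningful only if \<open>R\<close> has one.\<close>

definition top_of :: "nat set set \<Rightarrow> nat set" where
  "top_of R = (GREATEST S. S \<in> R)"

definition R_variety :: "nat set set \<Rightarrow> bool" where
  "R_variety R \<longleftrightarrow>
     R \<noteq> {} \<and> (\<forall>S\<in>R. numerical_semigroup S) \<and>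
     (\<exists>D\<in>R. \<forall>S\<in>R. S \<subseteq> D) \<and>
     (\<forall>S\<in>R. \<forall>T\<in>R. S \<inter> T \<in> R) \<and>
     (\<forall>S\<in>R. S \<noteq> top_of R \<longrightarrow> S \<union> {rel_frobenius (top_of R) S} \<in> R)"

text \<open>The smallest \<open>R\<close>-variety containing \<open>F\<close> with maximum \<open>D\<close>, as an intersection. The theorem
  \<open>R_variety_generated_smallest\<close> below shows that it is indeed the smallest one whenever \<open>D\<close> is a
  numerical semigroup and \<open>F\<close> consists of numerical semigroups contained in \<open>D\<close>.\<close>

definition R_variety_generated :: "nat set set \<Rightarrow> nat set \<Rightarrow> nat set set" where
  "R_variety_generated F D = \<Inter> {R. R_variety R \<and> F \<subseteq> R \<and> top_of R = D}"

definition R_monoid :: "nat set set \<Rightarrow> nat set \<Rightarrow> bool" where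
  "R_monoid R M \<longleftrightarrow> submonoid_nat M \<and> (\<exists>G. G \<noteq> {} \<and> G \<subseteq> R \<and> M = \<Inter> G)"

text \<open>For \<open>A \<subseteq> top_of R\<close> the intersected family is non-empty, as it contains \<open>top_of R\<close>.\<close>

definition R_monoid_generated :: "nat set set \<Rightarrow> nat set \<Rightarrow> nat set" where
  "R_monoid_generated R A = \<Inter> {M. R_monoid R M \<and> A \<subseteq> M}"

definition R_system_of_generators :: "nat set set \<Rightarrow> nat set \<Rightarrow> nat set \<Rightarrow> bool" where
  "R_system_of_generators R M A \<longleftrightarrow> A \<subseteq> top_of R \<and> M = R_monoid_generated R A"

definition minimal_R_system_of_generators :: "nat set set \<Rightarrow> nat set \<Rightarrow> nat set \<Rightarrow> bool" where
  "minimal_R_system_of_generators R M A \<longleftrightarrow>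
     R_system_of_generators R M A \<and> (\<forall>B. B \<subset> A \<longrightarrow> M \<noteq> R_monoid_generated R B)"

lemma top_of_eqI: "D \<in> R \<Longrightarrow> (\<And>S. S \<in> R \<Longrightarrow> S \<subseteq> D) \<Longrightarrow> top_of R = D"
  unfolding top_of_def by (rule Greatest_equality) auto

lemma R_variety_top_of:
  assumes "R_variety R"
  shows "top_of R \<in> R" and "S \<in> R \<Longrightarrow> S \<subseteq> top_of R"
proof -
  have "\<exists>D\<in>R. \<forall>S\<in>R. S \<subseteq> D"
    using assms unfolding R_variety_def by (elim conjE)
  then obtain D where D: "D \<in> R" "\<And>S. S \<in> R \<Longrightarrow> S \<subseteq> D" by blast
  then have "top_of R = D" by (rule top_of_eqI)
  then show "top_of R \<in> R" and "S \<in> R \<Longrightarrow> S \<subseteq> top_of R" using D by auto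
qed

lemma numerical_semigroup_Un_rel_frobenius:
  assumes S: "numerical_semigroup S" and D: "numerical_semigroup D" and "S \<subset> D"
  shows "numerical_semigroup (S \<union> {rel_frobenius D S})" and "rel_frobenius D S \<in> D"
proof -
  let ?f = "rel_frobenius D S"
  have "finite (UNIV - S)" using S by (simp add: numerical_semigroup_def)
  then have fin: "finite (D - S)" by (rule rev_finite_subset) auto
  have ne: "D - S \<noteq> {}" using \<open>S \<subset> D\<close> by auto
  have f: "?f \<in> D - S" unfolding rel_frobenius_def using fin ne by (rule Max_in)
  then show "?f \<in> D" by simp
  have big: "x \<in> S" if "x \<in> D" "x > ?f" for x
  proof (rule ccontr)
    assume "x \<notin> S"
    then have "x \<le> ?f" unfolding rel_frobenius_def using fin that(1) by (simp add: Max_ge)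
    then show False using that(2) by simp
  qed
  have sumD: "x + y \<in> D" if "x \<in> D" "y \<in> D" for x y
    using D that by (simp add: numerical_semigroup_def submonoid_nat_def)
  have sumS: "x + y \<in> S" if "x \<in> S" "y \<in> S" for x y
    using S that by (simp add: numerical_semigroup_def submonoid_nat_def)
  have zS: "0 \<in> S" using S by (simp add: numerical_semigroup_def submonoid_nat_def)
  have f0: "?f > 0" using f zS by (cases "?f = 0") auto
  have fs: "?f + x \<in> S \<union> {?f}" if "x \<in> S \<union> {?f}" for x
  proof (cases "x = 0")
    case False
    have "x \<in> D" using that f \<open>S \<subset> D\<close> by auto
    then show ?thesis using False big[of "?f + x"] sumD[of ?f x] f by auto
  qed simp
  have "x + y \<in> S \<union> {?f}" if x: "x \<in> S \<union> {?f}" and y: "y \<in> S \<union> {?f}" for x y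
  proof (cases "x = ?f \<or> y = ?f")
    case True
    then show ?thesis using fs[OF x] fs[OF y] by (metis add.commute)
  next
    case False
    then show ?thesis using x y sumS by simp
  qed
  then have "submonoid_nat (S \<union> {?f})"
    unfolding submonoid_nat_def using zS by simp
  moreover have "finite (UNIV - (S \<union> {?f}))"
    using \<open>finite (UNIV - S)\<close> by (rule rev_finite_subset) auto
  ultimately show "numerical_semigroup (S \<union> {?f})"
    unfolding numerical_semigroup_def by (rule conjI)
qed

lemma R_variety_subsemigroups:
  assumes D: "numerical_semigroup D"
  shows "R_variety {S. numerical_semigroup S \<and> S \<subseteq> D}"
    and "top_of {S. numerical_semigroup S \<and> S \<subseteq> D} = D"
proof -
  let ?R = "{S. numerical_semigroup S \<and> S \<subseteq> D}"
  show top: "top_of ?R = D" using D by (intro top_of_eqI) auto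
  have "numerical_semigroup (S \<inter> T)" if "numerical_semigroup S" "numerical_semigroup T" for S T
    using that by (auto simp: numerical_semigroup_def submonoid_nat_def Diff_Int)
  then have "\<forall>S\<in>?R. \<forall>T\<in>?R. S \<inter> T \<in> ?R" by auto
  moreover have "\<forall>S\<in>?R. S \<noteq> D \<longrightarrow> S \<union> {rel_frobenius D S} \<in> ?R"
  proof (intro ballI impI)
    fix S assume S: "S \<in> ?R" "S \<noteq> D"
    then have "S \<subset> D" "numerical_semigroup S" by auto
    then show "S \<union> {rel_frobenius D S} \<in> ?R"
      using numerical_semigroup_Un_rel_frobenius[of S D] D S by simp
  qed
  moreover have "?R \<noteq> {}" "\<forall>S\<in>?R. numerical_semigroup S" "\<exists>E\<in>?R. \<forall>S\<in>?R. S \<subseteq> E"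
    using D by auto
  ultimately show "R_variety ?R"
    unfolding R_variety_def top by (intro conjI)
qed

theorem R_variety_generated_smallest:
  assumes F: "\<And>S. S \<in> F \<Longrightarrow> numerical_semigroup S \<and> S \<subseteq> D" and D: "numerical_semigroup D"
  shows "R_variety (R_variety_generated F D)"
    and "F \<subseteq> R_variety_generated F D"
    and "top_of (R_variety_generated F D) = D"
    and "R_variety R \<Longrightarrow> F \<subseteq> R \<Longrightarrow> top_of R = D \<Longrightarrow> R_variety_generated F D \<subseteq> R"
proof -
  let ?G = "R_variety_generated F D"
  let ?R = "{S. numerical_semigroup S \<and> S \<subseteq> D}"
  show "F \<subseteq> ?G" by (auto simp: R_variety_generated_def)
  show "R_variety R \<Longrightarrow> F \<subseteq> R \<Longrightarrow> top_of R = D \<Longrightarrow> ?G \<subseteq> R" for R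
    by (auto simp: R_variety_generated_def)
  have "F \<subseteq> ?R" using F by auto
  then have sub: "?G \<subseteq> ?R"
    using R_variety_subsemigroups[OF D] by (auto simp: R_variety_generated_def)
  have DG: "D \<in> ?G" using R_variety_top_of(1) by (auto simp: R_variety_generated_def)
  show top: "top_of ?G = D" using DG sub by (intro top_of_eqI) auto
  have G_iff: "X \<in> ?G \<longleftrightarrow> (\<forall>R. R_variety R \<longrightarrow> F \<subseteq> R \<longrightarrow> top_of R = D \<longrightarrow> X \<in> R)" for X
    by (auto simp: R_variety_generated_def)
  have step: "S \<union> {rel_frobenius D S} \<in> R"
    if "R_variety R" "top_of R = D" "S \<in> R" "S \<noteq> D" for R S
    using that unfolding R_variety_def by simp
  have int: "S \<inter> T \<in> R" if "R_variety R" "S \<in> R" "T \<in> R" for R S T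
    using that unfolding R_variety_def by simp
  have "\<forall>S\<in>?G. \<forall>T\<in>?G. S \<inter> T \<in> ?G"
  proof (intro ballI)
    fix S T assume "S \<in> ?G" "T \<in> ?G"
    then show "S \<inter> T \<in> ?G" unfolding G_iff using int by simp
  qed
  moreover have "\<forall>S\<in>?G. S \<noteq> D \<longrightarrow> S \<union> {rel_frobenius D S} \<in> ?G"
  proof (intro ballI impI)
    fix S assume "S \<in> ?G" "S \<noteq> D"
    then show "S \<union> {rel_frobenius D S} \<in> ?G"
      unfolding G_iff using step by simp
  qed
  moreover have "?G \<noteq> {}" "\<forall>S\<in>?G. numerical_semigroup S" "\<exists>E\<in>?G. \<forall>S\<in>?G. S \<subseteq> E"
    using DG sub by auto
  ultimately show "R_variety ?G"
    unfolding R_variety_def top by (intro conjI)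
qed

end

theory Submission
  imports Defs
begin

text \<open>Write \<open>S\<^sub>n = S \<union> {d \<in> D. n \<le> d}\<close> for the truncations of a member \<open>S\<close> of \<open>F\<close>, and let \<open>R\<close> be the
  \<open>R\<close>-variety generated by \<open>F\<close> with maximum \<open>D\<close>. Adjoining relative Frobenius numbers to \<open>S\<close> one
  after the other runs through exactly these truncations, so all of them lie in \<open>R\<close>
  (\<open>R_variety_truncation\<close>). Conversely, every member of \<open>R\<close> is an intersection of truncations
  and \<open>D\<close>; elementwise, a member \<open>T\<close> omits \<open>d \<in> D\<close> only if some \<open>S \<in> F\<close> omits \<open>d\<close> and contains all
  elements of \<open>T\<close> below \<open>d\<close> (\<open>R_variety_generated_separation\<close>).

  A subset \<open>C\<close> of \<open>D\<close> lies in \<open>S\<^sub>n\<close> iff no element of \<open>C - S\<close> is smaller than \<open>n\<close>. The closure of \<open>C\<close>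
  under \<open>R\<close> is therefore determined by the minima of the sets \<open>C - S\<close>, where \<open>S \<in> F\<close>, and determines
  them. Two sets have the same closure iff these minima agree. The set \<open>B\<close> of the minima of \<open>A\<close> has
  the same minima as \<open>A\<close>, hence the same closure; and any set with the same closure as \<open>A\<close> must contain
  all these minima, i.e. contain \<open>B\<close>. So \<open>B\<close> is the least generating set of the closure of \<open>A\<close>, and
  thus the only minimal one.\<close>

text \<open>An \<open>R\<close>-monoid containing \<open>C\<close> is an intersection of members of \<open>R\<close>, each of which contains \<open>C\<close>,
  so closures can be computed with the members of \<open>R\<close> alone.\<close>

lemma R_monoid_generated_eq_Inter:
  assumes "R_variety R"
  shows "R_monoid_generated R C = \<Inter> {T \<in> R. C \<subseteq> T}"
proof
  have "R_monoid R T" if "T \<in> R" for T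
    using assms that unfolding R_variety_def R_monoid_def numerical_semigroup_def
    by (intro conjI exI[of _ "{T}"]) auto
  then show "R_monoid_generated R C \<subseteq> \<Inter> {T \<in> R. C \<subseteq> T}"
    unfolding R_monoid_generated_def by blast
  show "\<Inter> {T \<in> R. C \<subseteq> T} \<subseteq> R_monoid_generated R C"
    unfolding R_monoid_generated_def R_monoid_def by blast
qed

text \<open>Descending induction on \<open>n\<close>, starting above all gaps of \<open>S\<close>, where the truncation is \<open>S\<close> itself.
  Going from \<open>Suc n\<close> to \<open>n\<close> changes the truncation only if \<open>n \<in> top_of R - S\<close>, and
  then \<open>n\<close> is the largest element of \<open>top_of R\<close> that it lacks.\<close>

lemma R_variety_truncation:
  assumes R: "R_variety R" and S: "S \<in> R"
  shows "S \<union> {d \<in> top_of R. n \<le> d} \<in> R"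
proof -
  let ?D = "top_of R"
  let ?T = "\<lambda>n. S \<union> {d \<in> ?D. n \<le> d}"
  have adjoin: "\<forall>T\<in>R. T \<noteq> ?D \<longrightarrow> T \<union> {rel_frobenius ?D T} \<in> R"
    using R unfolding R_variety_def by (elim conjE)
  have fin: "finite (UNIV - S)"
    using R S unfolding R_variety_def numerical_semigroup_def by blast
  then obtain N where N: "\<forall>d\<in>UNIV - S. d < N"
    unfolding finite_nat_set_iff_bounded ..
  have tail: "{d \<in> ?D. n \<le> d} = {d \<in> ?D. Suc n \<le> d} \<union> (?D \<inter> {n})" for n
    by (auto simp: not_less_eq_eq)
  have step: "?T n \<in> R" if IH: "?T (Suc n) \<in> R" for n
  proof (cases "n \<in> ?D - S")
    case True
    then have "?D \<inter> {n} = {n}" by blast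
    then have split: "?T n = ?T (Suc n) \<union> {n}"
      by (simp only: tail[of n] Un_assoc)
    have "finite (?D - ?T (Suc n))"
      using fin by (rule rev_finite_subset) blast
    then have "rel_frobenius ?D (?T (Suc n)) = n"
      unfolding rel_frobenius_def using True by (intro Max_eqI) auto
    moreover have "?T (Suc n) \<noteq> ?D" using True by auto
    ultimately have "?T (Suc n) \<union> {n} \<in> R" using adjoin[rule_format, OF IH] by simp
    then show ?thesis by (simp only: split)
  next
    case False
    then have "?T n = ?T (Suc n)"
      unfolding tail[of n] by blast
    with IH show ?thesis by simp
  qed
  have "d \<in> S" if "max n N \<le> d" for d
    using N that by (meson DiffI UNIV_I leD max.boundedE)
  then have "?T (max n N) = S" by blast
  then have base: "?T (max n N) \<in> R" using S by simp
  have "n \<le> max n N" by simp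
  then show ?thesis
    using base step by (rule inc_induct)
qed

text \<open>The semigroups with the stated property form an \<open>R\<close>-variety. A witness \<open>S\<close> for \<open>T\<close> and \<open>d\<close>
  remains one when \<open>T\<close> shrinks, and also when the Frobenius number of \<open>T\<close> is adjoined, because this
  number exceeds every other element \<open>d\<close> of \<open>D\<close> that \<open>T\<close> lacks.\<close>

lemma R_variety_generated_separation:
  assumes F: "\<And>S. S \<in> F \<Longrightarrow> numerical_semigroup S \<and> S \<subseteq> D" and D: "numerical_semigroup D"
    and T: "T \<in> R_variety_generated F D" and d: "d \<in> D" "d \<notin> T"
  obtains S where "S \<in> F" "d \<notin> S" "\<And>t. t \<in> T \<Longrightarrow> t \<le> d \<Longrightarrow> t \<in> S"
proof -
  let ?P = "\<lambda>T. \<forall>d\<in>D - T. \<exists>S\<in>F. d \<notin> S \<and> (\<forall>t\<in>T. t \<le> d \<longrightarrow> t \<in> S)"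
  let ?V = "{S. numerical_semigroup S \<and> S \<subseteq> D}"
  define Q where "Q = {T \<in> ?V. ?P T}"
  have V: "R_variety ?V" and topV: "top_of ?V = D"
    using R_variety_subsemigroups[OF D] by blast+
  have DQ: "D \<in> Q" using D by (auto simp: Q_def)
  have top: "top_of Q = D" using DQ by (intro top_of_eqI) (auto simp: Q_def)
  have witness: "\<exists>S\<in>F. e \<notin> S \<and> (\<forall>t\<in>T. t \<le> e \<longrightarrow> t \<in> S)" if "T \<in> Q" "e \<in> D - T" for T e
  proof -
    have "?P T" using that(1) unfolding Q_def mem_Collect_eq by (rule conjunct2)
    then show ?thesis using that(2) by (rule bspec)
  qed
  have "X \<inter> Y \<in> Q" if "X \<in> Q" "Y \<in> Q" for X Y
  proof -
    have "X \<inter> Y \<in> ?V" using V that unfolding R_variety_def Q_def by blast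
    moreover have "?P (X \<inter> Y)"
    proof
      fix e assume "e \<in> D - (X \<inter> Y)"
      then consider "e \<in> D - X" | "e \<in> D - Y" by blast
      then show "\<exists>S\<in>F. e \<notin> S \<and> (\<forall>t\<in>X \<inter> Y. t \<le> e \<longrightarrow> t \<in> S)"
      proof cases
        case 1
        then show ?thesis using witness[OF that(1), of e] by blast
      next
        case 2
        then show ?thesis using witness[OF that(2), of e] by blast
      qed
    qed
    ultimately show ?thesis by (simp add: Q_def)
  qed
  moreover have "X \<union> {rel_frobenius D X} \<in> Q" if X: "X \<in> Q" "X \<noteq> D" for X
  proof -
    let ?f = "rel_frobenius D X"
    have "X \<in> ?V" using X by (simp add: Q_def)
    then have "X \<union> {?f} \<in> ?V"
      using V X(2) unfolding R_variety_def topV by blast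
    moreover have "?P (X \<union> {?f})"
    proof
      fix e assume e: "e \<in> D - (X \<union> {?f})"
      have "finite (D - X)"
        using X by (auto simp: Q_def numerical_semigroup_def intro: finite_subset[of _ "UNIV - X"])
      then have "e \<le> ?f" unfolding rel_frobenius_def using e by (intro Max_ge) auto
      then have "e < ?f" using e by auto
      moreover obtain S where "S \<in> F" "e \<notin> S" "\<forall>t\<in>X. t \<le> e \<longrightarrow> t \<in> S"
        using witness[OF X(1), of e] e by blast
      ultimately show "\<exists>S\<in>F. e \<notin> S \<and> (\<forall>t\<in>X \<union> {?f}. t \<le> e \<longrightarrow> t \<in> S)"
        by (intro bexI[of _ S]) auto
    qed
    ultimately show ?thesis by (simp add: Q_def)
  qed
  moreover have "Q \<noteq> {}" "\<forall>S\<in>Q. numerical_semigroup S" "\<exists>E\<in>Q. \<forall>S\<in>Q. S \<subseteq> E"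
    using DQ by (auto simp: Q_def)
  ultimately have "R_variety Q"
    unfolding R_variety_def top by (intro conjI ballI impI) simp_all
  moreover have "F \<subseteq> Q"
    using F by (auto simp: Q_def)
  ultimately have "T \<in> Q"
    using T top by (auto simp: R_variety_generated_def)
  then show thesis using witness[of T d] d that by blast
qed

theorem proposition5p10:
  fixes F :: "nat set set" and D A :: "nat set"
  assumes "\<And>S. S \<in> F \<Longrightarrow> numerical_semigroup S"
    and "numerical_semigroup D"
    and "\<And>S. S \<in> F \<Longrightarrow> S \<subseteq> D"
    and "A \<subseteq> D"
  shows "let R = R_variety_generated F D;
             M = R_monoid_generated R A;
             x = (\<lambda>S. LEAST a. a \<in> A \<and> a \<notin> S);
             B = {x S |S. S \<in> F \<and> \<not> A \<subseteq> S}
         in minimal_R_system_of_generators R M B \<and>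
            (\<forall>C. minimal_R_system_of_generators R M C \<longrightarrow> C = B)"
proof -
  define R where "R = R_variety_generated F D"
  define x where "x = (\<lambda>S. LEAST a. a \<in> A \<and> a \<notin> S)"
  define B where "B = {x S |S. S \<in> F \<and> \<not> A \<subseteq> S}"
  let ?gen = "R_monoid_generated R"
  have F: "numerical_semigroup S \<and> S \<subseteq> D" if "S \<in> F" for S
    using assms that by blast
  have R: "R_variety R" and FR: "F \<subseteq> R" and top: "top_of R = D"
    using R_variety_generated_smallest[of F D] F assms(2) unfolding R_def by blast+
  have gen: "?gen C = \<Inter> {T \<in> R. C \<subseteq> T}" for C
    using R by (rule R_monoid_generated_eq_Inter)
  have x: "x S \<in> A" "x S \<notin> S" if "\<not> A \<subseteq> S" for S
  proof -
    have "\<exists>a. a \<in> A \<and> a \<notin> S" using that by blast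
    then have "x S \<in> A \<and> x S \<notin> S" unfolding x_def by (rule LeastI_ex)
    then show "x S \<in> A" "x S \<notin> S" by auto
  qed
  have x_le: "x S \<le> a" if "a \<in> A" "a \<notin> S" for S a
    unfolding x_def using that by (intro Least_le) simp
  have BA: "B \<subseteq> A" using x by (auto simp: B_def)
  have "A \<subseteq> T" if T: "T \<in> R" "B \<subseteq> T" for T
  proof (rule ccontr)
    assume "\<not> A \<subseteq> T"
    then obtain a where a: "a \<in> A" "a \<notin> T" by blast
    then have "a \<in> D" using assms(4) by blast
    then obtain S where S: "S \<in> F" "a \<notin> S" "\<And>t. t \<in> T \<Longrightarrow> t \<le> a \<Longrightarrow> t \<in> S"
      using R_variety_generated_separation[OF F assms(2)] T(1) a(2) unfolding R_def by blast
    have nA: "\<not> A \<subseteq> S" using a S by blast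
    then have "x S \<in> T" using S(1) T(2) by (auto simp: B_def)
    then show False using S(3) x_le[OF a(1) S(2)] x(2)[OF nA] by blast
  qed
  then have genB: "?gen A = ?gen B"
    unfolding gen using BA by blast
  have least: "B \<subseteq> C" if C: "C \<subseteq> D" "?gen A = ?gen C" for C
  proof
    fix b assume "b \<in> B"
    then obtain S where S: "S \<in> F" "\<not> A \<subseteq> S" and b: "b = x S" by (auto simp: B_def)
    have trunc: "S \<union> {d \<in> D. n \<le> d} \<in> R" for n
      using R_variety_truncation[OF R] S(1) FR top by blast
    show "b \<in> C"
    proof (rule ccontr)
      assume nb: "b \<notin> C"
      \<comment> \<open>The truncation at \<open>b\<close> contains \<open>A\<close>, so it contains \<open>C\<close>. As \<open>b \<notin> C\<close>, so does the next one, which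
        hence contains \<open>A\<close>, although \<open>b\<close> is not in it.\<close>
      have "A \<subseteq> S \<union> {d \<in> D. b \<le> d}" using x_le assms(4) by (auto simp: b)
      then have "?gen A \<subseteq> S \<union> {d \<in> D. b \<le> d}" unfolding gen using trunc by blast
      moreover have "C \<subseteq> ?gen C" unfolding gen by blast
      ultimately have "C \<subseteq> S \<union> {d \<in> D. b \<le> d}" using C(2) by blast
      then have "C \<subseteq> S \<union> {d \<in> D. Suc b \<le> d}"
        using nb not_less_eq_eq order_antisym by blast
      then have "?gen C \<subseteq> S \<union> {d \<in> D. Suc b \<le> d}" unfolding gen using trunc by blast
      then have "?gen A \<subseteq> S \<union> {d \<in> D. Suc b \<le> d}" using C(2) by simp
      moreover have "A \<subseteq> ?gen A" unfolding gen by blast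
      ultimately show False using x[OF S(2)] by (auto simp: b)
    qed
  qed
  have BD: "B \<subseteq> D" using BA assms(4) by blast
  have "minimal_R_system_of_generators R (?gen A) B"
    unfolding minimal_R_system_of_generators_def R_system_of_generators_def top
  proof (intro conjI allI impI)
    show "?gen A \<noteq> ?gen C" if "C \<subset> B" for C
    proof
      assume "?gen A = ?gen C"
      moreover have "C \<subseteq> D" using that BD by (meson psubsetE subset_trans)
      ultimately have "B \<subseteq> C" using least[of C] by simp
      then show False using that by (simp add: psubset_eq subset_antisym)
    qed
  qed (fact BD genB)+
  moreover have "C = B" if "minimal_R_system_of_generators R (?gen A) C" for C
  proof -
    have C: "C \<subseteq> D" "?gen A = ?gen C" and min: "\<forall>E. E \<subset> C \<longrightarrow> ?gen A \<noteq> ?gen E"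
      using that
      unfolding minimal_R_system_of_generators_def R_system_of_generators_def top by blast+
    have "\<not> B \<subset> C" using min genB by blast
    then show ?thesis using least[OF C] by (simp add: psubset_eq)
  qed
  ultimately show ?thesis
    unfolding Let_def B_def x_def R_def by (intro conjI allI impI)
qed

end
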